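(* For every positive real number $x\in\mathbb{R}^{+}$, \[ \sum_{k=1}^{\lfloor x\rfloor}\frac{1}{k}=\log(x)+\gamma-\frac{B_{1}(\{x\})}{x}+\sum_{k=1}^{\infty}(-1)^{k+1}\frac{\sum_{l=1}^{k}\frac{(-1)^{l}}{l+1}S_{k}^{(1)}(l)B_{l+1}(\{x\})}{x(x+1)(x+2)\cdots(x+k)}, \] and also \[ \sum_{k=1}^{\lfloor x\rfloor}\frac{1}{k}=\log(x)+\gamma+\sum_{k=1}^{\infty}(-1)^{k+1}\frac{\sum_{l=1}^{k}\frac{(-1)^{l}}{l}S_{k}^{(1)}(l)B_{l}(\{x\})}{(x+1)(x+2)\cdots(x+k)}. \]
   Context: $\lfloor x\rfloor$ is the floor of $x$ and $\{x\}=x-\lfloor x\rfloor$ its fractional part; $\gamma$ is the Euler–Mascheroni constant. The Bernoulli polynomials $B_n(x)$ are defined by $\frac{te^{xt}}{e^{t}-1}=\sum_{n=0}^{\infty}\frac{B_n(x)}{n!}t^n$ for $|t|<2\pi$. For integers $k\ge l\ge 0$, the Stirling numbers of the first kind $S_k^{(1)}(l)$ are defined as the coefficients in the identity $(x)_k=(-1)^k\sum_{l=0}^{k}(-1)^l S_k^{(1)}(l)x^l$, where $(x)_k=x(x+1)\cdots(x+k-1)$ is the rising factorial. *)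

theory Defs
  imports "HOL-Complex_Analysis.Complex_Analysis"
    "HOL-Combinatorics.Stirling"
begin

text \<open>
  The quotient is one of formal power series: numerator and denominator have a common factor \<open>t\<close>, which the
  division cancels. The lemma \<open>bernoulli_poly_sums\<close> below gives the analytic
  generating function for \<open>\<bar>t\<bar> < 2\<pi>\<close>.
\<close>
definition bernoulli_poly :: "nat \<Rightarrow> 'a :: field_char_0 \<Rightarrow> 'a" where
  "bernoulli_poly n x = fact n * fps_nth (fps_X * fps_exp x / (fps_exp 1 - 1)) n"

text \<open>
  These are the signed Stirling numbers, obtained by comparing coefficients in
  \<open>(x)\<^sub>k = (-1)\<^sup>k (\<Sum>l\<le>k. (-1)\<^sup>l S\<^sub>k(l) x\<^sup>l)\<close>,
  where \<open>(x)\<^sub>k\<close> is the rising factorial.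
\<close>
definition stirling1 :: "nat \<Rightarrow> nat \<Rightarrow> int" where
  "stirling1 k l = (-1) ^ k * (-1) ^ l * coeff (pochhammer [:0, 1:] k) l"

lemma stirling1_eq_stirling: "stirling1 k l = (-1) ^ (k + l) * int (stirling k l)"
proof -
  have "pochhammer [:0, 1 :: int:] k = (\<Sum>j\<le>k. of_nat (stirling k j) * [:0, 1:] ^ j)"
    by (rule stirling_pochhammer [symmetric])
  also have "\<dots> = (\<Sum>j\<le>k. monom (int (stirling k j)) j)"
    by (intro sum.cong refl) (simp add: of_nat_poly monom_altdef)
  finally have "coeff (pochhammer [:0, 1 :: int:] k) l = int (stirling k l)"
    by (auto simp: coeff_sum coeff_monom if_distrib not_le cong: if_cong)
  then show ?thesis
    by (simp add: stirling1_def power_add)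
qed

lemma pochhammer_eq_sum_stirling1:
  "pochhammer x k = (-1) ^ k * (\<Sum>l=0..k. (-1) ^ l * of_int (stirling1 k l) * x ^ l)"
  for x :: "'a :: comm_ring_1"
proof -
  have "(-1) ^ k * (\<Sum>l=0..k. (-1) ^ l * of_int (stirling1 k l) * x ^ l) =
        (\<Sum>l\<le>k. ((-1) ^ (k + l) * (-1) ^ (k + l)) * of_nat (stirling k l) * x ^ l)"
    by (simp add: stirling1_eq_stirling sum_distrib_left atLeast0AtMost power_add mult_ac)
  also have "\<dots> = pochhammer x k"
    by (simp flip: stirling_pochhammer power_add mult_2 add: power_mult)
  finally show ?thesis by simp
qed

lemma subdegree_fps_exp_1_minus_1: "subdegree (fps_exp 1 - 1 :: 'a :: field_char_0 fps) = 1"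
  by (rule subdegreeI) auto

lemma fps_exp_1_minus_1_nonzero: "fps_exp 1 - 1 \<noteq> (0 :: 'a :: field_char_0 fps)"
  using subdegree_fps_exp_1_minus_1[where ?'a = 'a] by auto

lemma bernoulli_poly_of_real:
  "bernoulli_poly n (of_real x :: 'a :: real_field) = of_real (bernoulli_poly n x)"
proof -
  define Q :: "real fps" where "Q = fps_X * fps_exp x / (fps_exp 1 - 1)"
  define Q' :: "'a fps" where "Q' = Abs_fps (\<lambda>n. of_real (fps_nth Q n))"
  have "(fps_exp 1 - 1 :: real fps) dvd fps_X * fps_exp x"
    using fps_exp_1_minus_1_nonzero
    by (subst fps_dvd_iff) (auto simp only: subdegree_fps_exp_1_minus_1, auto)
  then have Q: "Q * (fps_exp 1 - 1) = fps_X * fps_exp x"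
    by (simp add: Q_def)
  have "Q' * (fps_exp 1 - 1) = fps_X * fps_exp (of_real x)"
  proof (rule fps_ext)
    fix n
    have "fps_nth (Q' * (fps_exp 1 - 1)) n = of_real (fps_nth (Q * (fps_exp 1 - 1)) n)"
      by (simp add: fps_mult_nth Q'_def if_distrib cong: if_cong)
    also have "\<dots> = fps_nth (fps_X * fps_exp (of_real x)) n"
      by (simp add: Q)
    finally show "fps_nth (Q' * (fps_exp 1 - 1)) n = fps_nth (fps_X * fps_exp (of_real x)) n" .
  qed
  then have "Q' = fps_X * fps_exp (of_real x) / (fps_exp 1 - 1)"
    using fps_exp_1_minus_1_nonzero[where ?'a = 'a] by (metis nonzero_mult_div_cancel_right)
  then show ?thesis
    unfolding bernoulli_poly_def Q_def [symmetric] by (metis Q'_def fps_nth_Abs_fps of_real_fact of_real_mult)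
qed

lemma bernoulli_poly_sums_complex:
  fixes x t :: complex
  assumes "norm t < 2 * pi" "t \<noteq> 0"
  shows "(\<lambda>n. bernoulli_poly n x / fact n * t ^ n) sums (t * exp (x * t) / (exp t - 1))"
proof -
  define f g :: "complex fps" where "f = fps_X * fps_exp x" and "g = fps_exp 1 - 1"
  have sg: "subdegree g = 1"
    unfolding g_def by (rule subdegree_fps_exp_1_minus_1)
  have ev: "eval_fps g z = exp z - 1" for z
    by (simp add: g_def eval_fps_diff)
  have rad: "fps_conv_radius g = \<infinity>"
    using fps_conv_radius_diff[of "fps_exp 1 :: complex fps" 1] by (simp add: g_def)
  have radf: "fps_conv_radius f = \<infinity>"
    using fps_conv_radius_mult[of "fps_X" "fps_exp x"] by (simp add: f_def)
  have nz: "eval_fps g z \<noteq> 0" if z: "z \<in> eball 0 (ereal (2 * pi))" "z \<noteq> 0" for z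
  proof
    assume "eval_fps g z = 0"
    then have "exp z = 1" by (simp add: ev)
    then obtain n :: int where n: "Re z = 0" "Im z = of_int (2 * n) * pi"
      by (auto simp: exp_eq_1)
    with z have "norm z < 2 * pi" "n \<noteq> 0" by (auto simp: complex_eq_iff in_eball_iff)
    moreover have "norm z = \<bar>of_int n\<bar> * (2 * pi)"
      using n by (simp add: cmod_eq_Im abs_mult)
    moreover have "\<bar>real_of_int n\<bar> \<ge> 1" using \<open>n \<noteq> 0\<close> by linarith
    ultimately show False using mult_right_mono[of 1 "\<bar>real_of_int n\<bar>" "2 * pi"] by simp
  qed
  have sub: "subdegree g \<le> subdegree f"
    by (simp add: sg f_def)
  have R: "Min {ereal (2 * pi), fps_conv_radius f, fps_conv_radius g} = ereal (2 * pi)"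
    by (simp add: rad radf)
  have r: "ereal (norm t) < ereal (2 * pi)" using assms by simp
  have "fps_conv_radius (f / g) \<ge> ereal (2 * pi)"
    using fps_conv_radius_divide[of g f "ereal (2 * pi)"] sub nz by (simp add: rad radf R)
  then have "(\<lambda>n. fps_nth (f / g) n * t ^ n) sums eval_fps (f / g) t"
    using r by (intro sums_eval_fps) (rule less_le_trans)
  also have "eval_fps (f / g) t = eval_fps f t / eval_fps g t"
    using eval_fps_divide[of g f "ereal (2 * pi)" t] sub nz r assms(2) by (simp add: rad radf R)
  also have "eval_fps f t = t * exp (x * t)"
    by (simp add: f_def eval_fps_mult)
  finally show ?thesis
    unfolding ev by (simp add: bernoulli_poly_def f_def g_def)
qed

lemma bernoulli_poly_sums:
  fixes x t :: real
  assumes "\<bar>t\<bar> < 2 * pi" "t \<noteq> 0"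
  shows "(\<lambda>n. bernoulli_poly n x / fact n * t ^ n) sums (t * exp (x * t) / (exp t - 1))"
proof -
  have "(\<lambda>n. complex_of_real (bernoulli_poly n x / fact n * t ^ n)) sums
          of_real (t * exp (x * t) / (exp t - 1))"
    using bernoulli_poly_sums_complex[of "of_real t" "of_real x"] assms
    by (simp add: bernoulli_poly_of_real flip: exp_of_real)
  then show ?thesis by (simp only: sums_of_real_iff)
qed

end

theory Submission
  imports Defs
begin

text \<open>
  Write \<open>\<psi>\<close> for the digamma function. The Newton series
  \<open>\<Sum>\<^bsub>n\<ge>1\<^esub> (b)\<^sub>n / (n (z)\<^sub>n) = \<psi>(z) - \<psi>(z - b)\<close> holds because both sides tend to \<open>0\<close> as
  \<open>z \<rightarrow> \<infinity>\<close> and have the same difference in \<open>z\<close>, the left-hand side by a telescoping sum.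
  Put \<open>b = t + s\<close> and \<open>z = x + 1 + s\<close>, so that \<open>z - b = x + 1 - t\<close>. For \<open>t = {x}\<close> the last term is
  \<open>\<psi>(\<lfloor>x\<rfloor> + 1)\<close>, a harmonic number minus \<open>\<gamma>\<close>. Integrating over \<open>t \<in> [0,1]\<close> instead gives
  \<open>\<integral> \<psi>(x + 1 - t) dt = ln \<Gamma>(x + 1) - ln \<Gamma>(x) = ln x\<close>. Subtracting the two eliminates \<open>\<psi>(z)\<close>:
  the harmonic number minus \<open>ln x + \<gamma>\<close> is a series whose numerators are
  \<open>\<integral> (t + s)\<^sub>n dt - ({x} + s)\<^sub>n\<close>. The two formulas are the cases \<open>s = -1\<close> and \<open>s = 0\<close>: a polynomial is
  determined by its forward difference and its mean over \<open>[0,1]\<close>, and this identifies the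
  numerators with the sums of Stirling numbers and Bernoulli polynomials.
\<close>

section \<open>The majorant n!/(x)_{n+1}\<close>

lemma pochhammer_nonneg_arg:
  fixes x :: real
  assumes "0 \<le> x"
  shows "0 \<le> pochhammer x n"
  unfolding pochhammer_prod using assms by (intro prod_nonneg) auto

lemma pochhammer_mono_arg:
  fixes x y :: real
  assumes "0 \<le> x" "x \<le> y"
  shows "pochhammer x n \<le> pochhammer y n"
  unfolding pochhammer_prod using assms by (intro prod_mono) auto

text \<open>The drop is the term times x/(x + n + 1), a factor of order 1/n. Hence the telescoping
  series of drops controls the series of terms divided by n + 1.\<close>

lemma fact_over_pochhammer_diff:
  fixes x :: real
  assumes "x > 0"
  shows "fact n / pochhammer x (Suc n) - fact (Suc n) / pochhammer x (Suc (Suc n)) =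
           x * (fact n / pochhammer x (Suc n)) / (x + real (Suc n))"
proof -
  have "pochhammer x (Suc n) > 0" "x + real (Suc n) > 0"
    using assms by (auto intro!: pochhammer_pos)
  then show ?thesis
    by (simp add: pochhammer_Suc[of x "Suc n"] divide_simps del: of_nat_Suc fact_Suc)
       (simp add: algebra_simps)
qed

lemma decseq_fact_over_pochhammer:
  fixes x :: real
  assumes "x > 0"
  shows "decseq (\<lambda>n. fact n / pochhammer x (Suc n))"
proof (rule decseq_SucI)
  fix n
  have "0 \<le> x * (fact n / pochhammer x (Suc n)) / (x + real (Suc n))"
    using assms by (intro divide_nonneg_pos mult_nonneg_nonneg pochhammer_pos) auto
  then show "fact (Suc n) / pochhammer x (Suc (Suc n)) \<le> fact n / pochhammer x (Suc n)"
    using fact_over_pochhammer_diff[OF assms, of n] by linarith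
qed

text \<open>The sequence \<open>w\<close> decreases and is positive, so it has a limit L and its
  drops are summable; up to a constant they dominate \<open>w n / (n + 1)\<close>. If L were
  positive, the harmonic series would converge by comparison.\<close>

lemma
  fixes x :: real
  assumes "x > 0"
  shows summable_fact_over_pochhammer: "summable (\<lambda>n. fact n / pochhammer x (Suc n) / real (Suc n))"
    and fact_over_pochhammer_tendsto_0: "(\<lambda>n. fact n / pochhammer x (Suc n)) \<longlonglongrightarrow> 0"
proof -
  define w where "w = (\<lambda>n. fact n / pochhammer x (Suc n))"
  have pos: "w n > 0" for n
    using assms unfolding w_def by (intro divide_pos_pos pochhammer_pos) auto
  have dec: "decseq w"
    unfolding w_def by (rule decseq_fact_over_pochhammer[OF assms])
  obtain L where L: "w \<longlonglongrightarrow> L" and L_le: "\<And>n. L \<le> w n"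
    using decseq_convergent[OF dec, of 0] pos by (metis less_imp_le)
  have "L \<ge> 0"
    using L pos by (intro LIMSEQ_le_const[OF L]) (auto intro: less_imp_le)
  have diff: "w n - w (Suc n) = x * w n / (x + real (Suc n))" for n
    using fact_over_pochhammer_diff[OF assms, of n] by (simp only: w_def)
  have "summable (\<lambda>n. (1 + x) / x * (w n - w (Suc n)))"
    by (intro summable_mult telescope_summable'[OF L])
  moreover have "norm (w n / real (Suc n)) \<le> (1 + x) / x * (w n - w (Suc n))" for n
  proof -
    \<comment> \<open>The constant 1 + x works because x + (n + 1) is at most (1 + x)(n +
      1).\<close>
    have "1 / real (Suc n) \<le> (1 + x) / (x + real (Suc n))"
      using assms by (simp add: field_simps)
    then have "w n * (1 / real (Suc n)) \<le> w n * ((1 + x) / (x + real (Suc n)))"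
      using pos by (intro mult_left_mono) (auto intro: less_imp_le)
    then show ?thesis
      using pos[of n] assms by (simp add: diff mult_ac)
  qed
  ultimately have *: "summable (\<lambda>n. w n / real (Suc n))"
    by (rule summable_comparison_test'[where N = 0])
  then show "summable (\<lambda>n. fact n / pochhammer x (Suc n) / real (Suc n))"
    by (simp only: w_def)
  have "L = 0"
  proof (rule ccontr)
    assume "L \<noteq> 0"
    with \<open>L \<ge> 0\<close> have "L > 0" by simp
    have "summable (\<lambda>n. L / real (Suc n))"
      using L_le \<open>L > 0\<close>
      by (intro summable_comparison_test'[OF *, of 0]) (auto intro!: divide_right_mono)
    then have "summable (\<lambda>n. inverse L * (L / real (Suc n)))"
      by (rule summable_mult)
    then have "summable (\<lambda>n. inverse (real (Suc n)))"
      using \<open>L > 0\<close> by (simp add: field_simps)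
    then show False
      using not_summable_harmonic[where ?'a = real] summable_Suc_iff[of "\<lambda>n. inverse (real n)"] by simp
  qed
  with L show "(\<lambda>n. fact n / pochhammer x (Suc n)) \<longlonglongrightarrow> 0"
    by (simp only: w_def)
qed

section \<open>The Newton series of the digamma function\<close>

lemma pochhammer_quotient_diff:
  fixes b z :: real
  assumes "z > 0"
  shows "pochhammer b (Suc n) / (real (Suc n) * pochhammer z (Suc n)) -
           pochhammer b (Suc n) / (real (Suc n) * pochhammer (z + 1) (Suc n)) =
         pochhammer b (Suc n) / pochhammer z (Suc (Suc n))"
proof -
  define P Q where "P = pochhammer z (Suc n)" and "Q = pochhammer (z + 1) (Suc n)"
  have P: "P > 0" and Q: "Q > 0"
    using assms by (auto simp: P_def Q_def intro!: pochhammer_pos)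
  have z: "z + real (Suc n) > 0" using assms by simp
  have 1: "pochhammer z (Suc (Suc n)) = P * (z + real (Suc n))"
    by (simp add: P_def pochhammer_Suc[of z "Suc n"])
  \<comment> \<open>Both sides are (z)_{n+2}, with the first factor split off on the left and the
    last factor on the right.\<close>
  have "z * Q = P * (z + real (Suc n))"
    using 1 by (simp add: Q_def pochhammer_rec[of z "Suc n"])
  then have Q_eq: "Q = P * (z + real (Suc n)) / z"
    using assms by (simp add: field_simps)
  show ?thesis
    unfolding P_def [symmetric] Q_def [symmetric] 1 Q_eq using P z assms
    by (simp add: divide_simps del: of_nat_Suc) (simp add: algebra_simps)
qed

text \<open>Telescoping: with u_n = (b)_{n+1}/(z)_{n+1}, the summand is (u_n - u_{n+1})/(z - b), and
  u_0/(z - b) = 1/(z - b) - 1/z.\<close>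

lemma sum_pochhammer_quotient:
  fixes b z :: real
  assumes "z > 0" "z > b"
  shows "(\<Sum>n<N. pochhammer b (Suc n) / pochhammer z (Suc (Suc n))) =
           1 / (z - b) - 1 / z - pochhammer b (Suc N) / pochhammer z (Suc N) / (z - b)"
proof (induction N)
  case 0
  show ?case using assms by (simp add: divide_simps)
next
  case (Suc N)
  define P B where "P = pochhammer z (Suc N)" and "B = pochhammer b (Suc N)"
  have P: "P > 0"
    using assms by (auto simp: P_def intro!: pochhammer_pos)
  have z: "z + real (Suc N) > 0" using assms by simp
  have "B / (P * (z + real (Suc N))) - B / P / (z - b) =
          - (B * (b + real (Suc N)) / (P * (z + real (Suc N))) / (z - b))"
    using P z assms
    by (simp add: divide_simps del: of_nat_Suc) (simp add: algebra_simps)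
  then show ?case
    by (simp add: Suc.IH pochhammer_Suc[of z "Suc N"] pochhammer_Suc[of b "Suc N"]
          flip: P_def B_def)
qed

text \<open>Iterating the shift from z to z + 1 in the Newton series produces exactly these
  summands, so this links that series to \<open>Digamma\<close>.\<close>

lemma Digamma_diff_sums:
  fixes b z :: real
  assumes "z > 0" "z > b"
  shows "(\<lambda>k. 1 / (z + real k - b) - 1 / (z + real k)) sums (Digamma z - Digamma (z - b))"
proof -
  have *: "(\<lambda>k. inverse (real (Suc k)) - inverse (y + real k)) sums (Digamma y + euler_mascheroni)"
    if "y > 0" for y
    using summable_Digamma[of y] that by (simp add: Digamma_def summable_sums)
  have "(\<lambda>k. inverse (z - b + real k) - inverse (z + real k)) sums (Digamma z - Digamma (z - b))"
    using sums_diff[OF *[of z] *[of "z - b"]] assms by simp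
  then show ?thesis
    by (simp add: inverse_eq_divide algebra_simps)
qed

text \<open>The majorant gives absolute convergence and makes the boundary term of the telescoping
  sum vanish. Its parameter \<open>x\<close> is kept apart from \<open>z\<close> because the later
  uses have z = x as well as z = x + 1.\<close>

lemma Digamma_Newton_series:
  fixes b z x K :: real
  assumes "z > 0" "z > b" "x > 0"
    and bound: "\<And>n. \<bar>pochhammer b (Suc n)\<bar> / pochhammer z (Suc n) \<le>
                       K * (fact n / pochhammer x (Suc n))"
  shows "(\<lambda>n. pochhammer b (Suc n) / (real (Suc n) * pochhammer z (Suc n)))
           sums (Digamma z - Digamma (z - b))"
proof -
  define f where "f = (\<lambda>z n. pochhammer b (Suc n) / (real (Suc n) * pochhammer z (Suc n)))"
  define S where "S = (\<Sum>n. \<bar>f z n\<bar>)"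
  have pos: "pochhammer y n > 0" if "y \<ge> z" for y n
    using that assms by (intro pochhammer_pos) auto
  have "\<bar>f z n\<bar> \<le> K * (fact n / pochhammer x (Suc n) / real (Suc n))" for n
  proof -
    have "\<bar>f z n\<bar> = \<bar>pochhammer b (Suc n)\<bar> / pochhammer z (Suc n) / real (Suc n)"
      using pos[of z "Suc n"] by (simp add: f_def abs_mult mult_ac del: of_nat_Suc)
    also have "\<dots> \<le> K * (fact n / pochhammer x (Suc n)) / real (Suc n)"
      by (intro divide_right_mono bound) auto
    finally show ?thesis by (simp add: mult_ac)
  qed
  then have abs_summable: "summable (\<lambda>n. \<bar>f z n\<bar>)"
    by (intro summable_comparison_test'[where N = 0,
          OF summable_mult[OF summable_fact_over_pochhammer[OF \<open>x > 0\<close>], of K]]) auto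
  \<comment> \<open>Only the factors after the first are compared. The quotient z/y of the first
    factors survives as a gain, which later forces the series to 0 as y grows.\<close>
  have shift_le: "\<bar>f y n\<bar> \<le> z / y * \<bar>f z n\<bar>" if "y \<ge> z" for y n
  proof -
    have "pochhammer z (Suc n) * y = z * y * pochhammer (z + 1) n"
      by (simp add: pochhammer_rec)
    also have "\<dots> \<le> z * y * pochhammer (y + 1) n"
      using that assms by (intro mult_left_mono pochhammer_mono_arg) auto
    also have "\<dots> = z * pochhammer y (Suc n)"
      by (simp add: pochhammer_rec)
    finally have "1 / pochhammer y (Suc n) \<le> z / y / pochhammer z (Suc n)"
      using pos[of y "Suc n"] pos[of z "Suc n"] that assms by (simp add: field_simps)
    then have "\<bar>pochhammer b (Suc n)\<bar> / real (Suc n) * (1 / pochhammer y (Suc n)) \<le>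
               \<bar>pochhammer b (Suc n)\<bar> / real (Suc n) * (z / y / pochhammer z (Suc n))"
      by (intro mult_left_mono) auto
    then show ?thesis
      using pos[of y "Suc n"] pos[of z "Suc n"] that by (simp add: f_def abs_mult mult_ac del: of_nat_Suc)
  qed
  have abs_summable': "summable (\<lambda>n. \<bar>f y n\<bar>)" if "y \<ge> z" for y
    using shift_le[OF that]
    by (intro summable_comparison_test'[where N = 0, OF summable_mult[OF abs_summable, of "z / y"]]) auto
  have summable: "summable (f y)" if "y \<ge> z" for y
    using abs_summable'[OF that] by (rule summable_rabs_cancel)
  \<comment> \<open>The termwise difference in y is the telescoping summand, whose boundary term
    tends to 0 by \<open>bound\<close>.\<close>
  have step: "suminf (f y) - suminf (f (y + 1)) = 1 / (y - b) - 1 / y" if "y \<ge> z" for y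
  proof -
    have y: "y > 0" "y > b" using that assms by auto
    have "(\<lambda>n. pochhammer b (Suc n) / pochhammer y (Suc n)) \<longlonglongrightarrow> 0"
    proof (rule Lim_null_comparison)
      have "\<bar>pochhammer b (Suc n)\<bar> / pochhammer y (Suc n) \<le> K * (fact n / pochhammer x (Suc n))" for n
      proof -
        have "\<bar>pochhammer b (Suc n)\<bar> / pochhammer y (Suc n) \<le> \<bar>pochhammer b (Suc n)\<bar> / pochhammer z (Suc n)"
          using that assms pos[of z "Suc n"] pos[of y "Suc n"]
          by (intro divide_left_mono pochhammer_mono_arg mult_pos_pos) auto
        with bound[of n] show ?thesis by linarith
      qed
      then show "\<forall>\<^sub>F n in sequentially. norm (pochhammer b (Suc n) / pochhammer y (Suc n)) \<le>
                   K * (fact n / pochhammer x (Suc n))"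
        using pos[OF that] by (intro always_eventually) (simp add: abs_of_pos)
      show "(\<lambda>n. K * (fact n / pochhammer x (Suc n))) \<longlonglongrightarrow> 0"
        using tendsto_mult_right_zero[OF fact_over_pochhammer_tendsto_0[OF \<open>x > 0\<close>]] .
    qed
    then have "(\<lambda>N. 1 / (y - b) - 1 / y - pochhammer b (Suc N) / pochhammer y (Suc N) / (y - b))
                 \<longlonglongrightarrow> 1 / (y - b) - 1 / y - 0 / (y - b)"
      using y by (intro tendsto_intros) auto
    then have "(\<lambda>n. f y n - f (y + 1) n) sums (1 / (y - b) - 1 / y)"
      unfolding sums_def f_def pochhammer_quotient_diff[OF y(1)] sum_pochhammer_quotient[OF y] by simp
    moreover have "(\<lambda>n. f y n - f (y + 1) n) sums (suminf (f y) - suminf (f (y + 1)))"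
      using that by (intro sums_diff summable_sums summable) auto
    ultimately show ?thesis by (rule sums_unique2[symmetric])
  qed
  have partial: "(\<Sum>k<M. 1 / (z + real k - b) - 1 / (z + real k)) = suminf (f z) - suminf (f (z + real M))"
    for M
  proof (induction M)
    case (Suc M)
    show ?case
      using Suc step[of "z + real M"] by (simp add: add_ac)
  qed simp
  have "(\<lambda>M. suminf (f (z + real M))) \<longlonglongrightarrow> 0"
  proof (rule Lim_null_comparison)
    have "norm (suminf (f (z + real M))) \<le> z / (z + real M) * S" for M
    proof -
      have "norm (suminf (f (z + real M))) \<le> (\<Sum>n. \<bar>f (z + real M) n\<bar>)"
        using summable_rabs[OF abs_summable'[of "z + real M"]] by simp
      also have "\<dots> \<le> (\<Sum>n. z / (z + real M) * \<bar>f z n\<bar>)"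
        by (intro suminf_le shift_le abs_summable' summable_mult abs_summable) auto
      also have "\<dots> = z / (z + real M) * S"
        unfolding S_def by (rule suminf_mult[OF abs_summable])
      finally show ?thesis .
    qed
    then show "\<forall>\<^sub>F M in sequentially. norm (suminf (f (z + real M))) \<le> z / (z + real M) * S"
      by (intro always_eventually) auto
    have "(\<lambda>M. z / (z + real M)) \<longlonglongrightarrow> 0"
      by (intro tendsto_divide_0[OF tendsto_const] filterlim_at_top_imp_at_infinity
            filterlim_tendsto_add_at_top[OF tendsto_const] filterlim_real_sequentially)
    then show "(\<lambda>M. z / (z + real M) * S) \<longlonglongrightarrow> 0"
      by (rule tendsto_mult_left_zero)
  qed
  then have "(\<lambda>M. suminf (f z) - suminf (f (z + real M))) \<longlonglongrightarrow> suminf (f z) - 0"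
    by (intro tendsto_intros)
  then have "(\<lambda>k. 1 / (z + real k - b) - 1 / (z + real k)) sums suminf (f z)"
    by (simp add: sums_def partial)
  then have "suminf (f z) = Digamma z - Digamma (z - b)"
    using Digamma_diff_sums[OF assms(1,2)] by (rule sums_unique2)
  then show ?thesis
    using summable_sums[OF summable[of z]] by (simp add: f_def)
qed

section \<open>Averaging over the unit interval\<close>

lemma has_integral_Digamma_reflected:
  fixes x :: real
  assumes "x > 0"
  shows "((\<lambda>t. Digamma (x + 1 - t)) has_integral ln x) {0..1}"
proof -
  have "((\<lambda>t. Digamma (x + 1 - t)) has_integral (- ln_Gamma (x + 1 - 1) - (- ln_Gamma (x + 1 - 0)))) {0..1}"
  proof (rule fundamental_theorem_of_calculus)
    fix t :: real assume t: "t \<in> {0..1}"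
    have "((\<lambda>t. - ln_Gamma (x + 1 - t)) has_real_derivative - (Digamma (x + 1 - t) * (0 - 1)))
            (at t within {0..1})"
      using t assms
      by (intro DERIV_minus DERIV_chain2[OF has_field_derivative_ln_Gamma_real])
         (auto intro!: derivative_eq_intros)
    then show "((\<lambda>t. - ln_Gamma (x + 1 - t)) has_vector_derivative Digamma (x + 1 - t)) (at t within {0..1})"
      by (simp add: has_real_derivative_iff_has_vector_derivative)
  qed simp
  moreover have "exp (ln_Gamma (x + 1)) = x * exp (ln_Gamma x)"
    using Gamma_plus1[of x] assms nonpos_Ints_nonpos[of x] by (force simp: Gamma_real_pos_exp)
  then have "ln_Gamma (x + 1) = ln x + ln_Gamma x"
    using assms by (metis exp_gt_zero less_numeral_extra(3) ln_exp ln_mult_pos)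
  ultimately show ?thesis by simp
qed

text \<open>The constant \<open>K\<close> may depend on x but not on t: this uniformity gives
  uniform convergence on [0,1] and so permits integration term by term.\<close>

lemma harm_inverse_factorial_sums:
  fixes x s K :: real
  defines "e \<equiv> \<lambda>n. integral {0..1} (\<lambda>t. pochhammer (t + s) n)"
  assumes "x > 0" "x + 1 + s > 0"
    and bound: "\<And>t n. t \<in> {0..1} \<Longrightarrow> \<bar>pochhammer (t + s) (Suc n)\<bar> / pochhammer (x + 1 + s) (Suc n) \<le>
                       K * (fact n / pochhammer x (Suc n))"
  shows "(\<lambda>n. (e (Suc n) - pochhammer (frac x + s) (Suc n)) /
                (real (Suc n) * pochhammer (x + 1 + s) (Suc n)))
           sums (harm (nat \<lfloor>x\<rfloor>) - ln x - euler_mascheroni)"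
proof -
  define z where "z = x + 1 + s"
  define f where "f = (\<lambda>n t. pochhammer (t + s) (Suc n) / (real (Suc n) * pochhammer z (Suc n)))"
  have z: "z > 0" using assms by (simp add: z_def)
  have cont: "continuous_on A (\<lambda>t. pochhammer (t + s) n)" for A n
    unfolding pochhammer_prod by (intro continuous_intros)
  have sums: "(\<lambda>n. f n t) sums (Digamma z - Digamma (x + 1 - t))" if "t \<in> {0..1}" for t
    using Digamma_Newton_series[of z "t + s" x K] bound[OF that] that z \<open>x > 0\<close>
    by (simp add: f_def z_def)
  have "uniform_limit {0..1} (\<lambda>N t. \<Sum>n<N. f n t) (\<lambda>t. \<Sum>n. f n t) sequentially"
  proof (rule Weierstrass_m_test)
    show "summable (\<lambda>n. K * (fact n / pochhammer x (Suc n) / real (Suc n)))"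
      by (intro summable_mult summable_fact_over_pochhammer assms)
    fix n t assume t: "t \<in> {0..1::real}"
    have "norm (f n t) = \<bar>pochhammer (t + s) (Suc n)\<bar> / pochhammer z (Suc n) / real (Suc n)"
      using pochhammer_pos[OF z, of "Suc n"] by (simp add: f_def abs_mult mult_ac del: of_nat_Suc)
    also have "\<dots> \<le> K * (fact n / pochhammer x (Suc n)) / real (Suc n)"
      unfolding z_def by (intro divide_right_mono bound t) auto
    finally show "norm (f n t) \<le> K * (fact n / pochhammer x (Suc n) / real (Suc n))"
      by (simp add: mult_ac)
  qed
  then have "uniform_limit {0..1} (\<lambda>N t. \<Sum>n<N. f n t) (\<lambda>t. Digamma z - Digamma (x + 1 - t)) sequentially"
    using sums by (subst (asm) uniform_limit_cong') (auto simp: sums_iff)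
  then obtain I J where I: "\<And>N. ((\<lambda>t. \<Sum>n<N. f n t) has_integral I N) {0..1}"
      and J: "((\<lambda>t. Digamma z - Digamma (x + 1 - t)) has_integral J) {0..1}" and lim: "I \<longlonglongrightarrow> J"
    by (rule uniform_limit_integral)
      (use pochhammer_pos[OF z] in \<open>auto simp: f_def less_imp_neq [THEN not_sym] intro!: continuous_intros cont\<close>)
  have "((\<lambda>t. Digamma z - Digamma (x + 1 - t)) has_integral (Digamma z - ln x)) {0..1}"
    using has_integral_diff[OF has_integral_const_real[of "Digamma z" 0 1]
        has_integral_Digamma_reflected[OF \<open>x > 0\<close>]] by simp
  with J have J_eq: "J = Digamma z - ln x"
    by (rule has_integral_unique)
  have "(f n has_integral (e (Suc n) / (real (Suc n) * pochhammer z (Suc n)))) {0..1}" for n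
    unfolding f_def e_def
    by (intro has_integral_divide integrable_integral integrable_continuous_real cont)
  then have "I = (\<lambda>N. \<Sum>n<N. e (Suc n) / (real (Suc n) * pochhammer z (Suc n)))"
    by (intro ext has_integral_unique[OF I] has_integral_sum) auto
  with lim have e_sums: "(\<lambda>n. e (Suc n) / (real (Suc n) * pochhammer z (Suc n))) sums (Digamma z - ln x)"
    by (simp only: sums_def J_eq)
  \<comment> \<open>At t = frac x the digamma argument is the integer floor(x) + 1, where
    \<open>Digamma\<close> is the harmonic number of floor(x) minus Euler's constant.\<close>
  have fr: "x + 1 - frac x = real (Suc (nat \<lfloor>x\<rfloor>))"
    using \<open>x > 0\<close> by (simp add: frac_def)
  have "frac x \<in> {0..1}"
    using frac_lt_1[of x] by (simp add: less_imp_le)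
  from sums_diff[OF e_sums sums[OF this]] show ?thesis
    unfolding fr Digamma_of_nat by (simp add: f_def z_def algebra_simps diff_divide_distrib)
qed

section \<open>Polynomials determined by forward difference and mean\<close>

lemma periodic_polynomial_constant:
  fixes f :: "real \<Rightarrow> real"
  assumes "real_polynomial_function f" and per: "\<And>y. f (y + 1) = f y"
  shows "f y = f 0"
proof -
  obtain a n where f: "f = (\<lambda>x. \<Sum>i\<le>n. a i * x ^ i)"
    using real_polynomial_function_imp_sum[OF assms(1)] by blast
  define p where "p = (\<Sum>i\<le>n. monom (a i) i) - [:f 0:]"
  have p: "poly p x = f x - f 0" for x
    by (simp add: p_def f poly_sum poly_monom)
  \<comment> \<open>Periodicity gives f - f 0 a zero at every natural number, too many for a nonzero
    polynomial.\<close>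
  have "f (real m) = f 0" for m
  proof (induction m)
    case (Suc m)
    then show ?case using per[of "real m"] by (simp add: add.commute)
  qed simp
  then have "range real \<subseteq> {x. poly p x = 0}"
    by (auto simp: p)
  moreover have "infinite (range real)"
    by (rule range_inj_infinite) (rule inj_of_nat)
  ultimately have "p = 0"
    using poly_roots_finite[of p] finite_subset by blast
  with p[of y] show ?thesis by simp
qed

text \<open>The polynomial f - g has period 1, hence is constant; integrating over [0,1], where f
  has mean 0, evaluates the constant. Below, f is built from Bernoulli polynomials and g is
  explicit.\<close>

lemma polynomial_eq_if_same_difference:
  fixes f g :: "real \<Rightarrow> real"
  assumes f: "real_polynomial_function f" and g: "real_polynomial_function g"
    and diff: "\<And>y. f (y + 1) - f y = g (y + 1) - g y"
    and mean: "(f has_integral 0) {0..1}"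
  shows "f y = g y - integral {0..1} g"
proof -
  define d where "d = f 0 - g 0"
  have const: "f y - g y = d" for y
    unfolding d_def
  proof (rule periodic_polynomial_constant)
    show "f (y + 1) - g (y + 1) = f y - g y" for y
      using diff[of y] by simp
  qed (intro real_polynomial_function_diff f g)
  have "g integrable_on {0..1}"
    using g by (intro integrable_continuous_real continuous_on_polymonial_function)
      (simp flip: real_polynomial_function_eq)
  then have "((\<lambda>y. f y - g y) has_integral (0 - integral {0..1} g)) {0..1}"
    by (intro has_integral_diff mean integrable_integral)
  moreover have "((\<lambda>y. f y - g y) has_integral d) {0..1}"
    unfolding const using has_integral_const_real[of d 0 1] by simp
  ultimately have "0 - integral {0..1} g = d"
    by (rule has_integral_unique)
  with const[of y] show ?thesis by simp
qed

section \<open>Bernoulli polynomials: difference, derivative and mean\<close>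

lemma bernoulli_fps_eq:
  "fps_X * fps_exp x / (fps_exp 1 - 1) = fps_exp x * (fps_X / (fps_exp 1 - 1) :: 'a :: field_char_0 fps)"
  and bernoulli_fps_mult: "(fps_X / (fps_exp 1 - 1)) * (fps_exp 1 - 1) = (fps_X :: 'a fps)"
proof -
  have "(fps_exp 1 - 1 :: 'a fps) dvd fps_X"
    using fps_exp_1_minus_1_nonzero
    by (subst fps_dvd_iff) (auto simp only: subdegree_fps_exp_1_minus_1, auto)
  then show "fps_X * fps_exp x / (fps_exp 1 - 1) = fps_exp x * (fps_X / (fps_exp 1 - 1) :: 'a fps)"
    and "(fps_X / (fps_exp 1 - 1)) * (fps_exp 1 - 1) = (fps_X :: 'a fps)"
    by (metis div_mult_swap mult.commute, rule dvd_div_mult_self)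
qed

text \<open>The definition takes a separate power series for each x. Splitting off the factor free
  of x exhibits a polynomial in x, from which polynomiality and the derivative are read off.\<close>

lemma bernoulli_poly_eq_sum:
  "bernoulli_poly n x = fact n *
     (\<Sum>i\<le>n. fps_nth (fps_X / (fps_exp 1 - 1)) i * (x ^ (n - i) / fact (n - i)))"
  unfolding bernoulli_poly_def bernoulli_fps_eq
  by (simp add: mult.commute[of "fps_exp x"] fps_mult_nth atLeast0AtMost)

text \<open>Passing from x to x + 1 multiplies the generating function by e^t; the difference
  carries the factor e^t - 1, which cancels the denominator and leaves t e^(xt).\<close>

lemma bernoulli_poly_diff:
  fixes x :: "'a :: field_char_0"
  shows "bernoulli_poly (Suc n) (x + 1) - bernoulli_poly (Suc n) x = of_nat (Suc n) * x ^ n"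
proof -
  let ?Q = "fps_X / (fps_exp 1 - 1) :: 'a fps"
  have "fps_exp (x + 1) * ?Q - fps_exp x * ?Q = fps_exp x * (?Q * (fps_exp 1 - 1))"
    by (simp add: fps_exp_add_mult algebra_simps)
  also have "\<dots> = fps_X * fps_exp x"
    unfolding bernoulli_fps_mult by (rule mult.commute)
  finally have "fps_nth (fps_exp (x + 1) * ?Q - fps_exp x * ?Q) (Suc n) = fps_nth (fps_X * fps_exp x) (Suc n)"
    by simp
  then have *: "fps_nth (fps_exp (x + 1) * ?Q) (Suc n) - fps_nth (fps_exp x * ?Q) (Suc n) = x ^ n / fact n"
    by simp
  show ?thesis
    unfolding bernoulli_poly_def bernoulli_fps_eq right_diff_distrib [symmetric] * by simp
qed

lemma real_polynomial_function_bernoulli_poly: "real_polynomial_function (bernoulli_poly n)"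
proof -
  have *: "real_polynomial_function (\<lambda>x. c * (x ^ m / d))" for c d :: real and m
    by (intro real_polynomial_function.intros(2,4) real_polynomial_function_divide
          real_polynomial_function_power real_polynomial_function.intros(1)[OF bounded_linear_ident])
  show ?thesis
    unfolding bernoulli_poly_eq_sum [abs_def]
    by (rule real_polynomial_function.intros(4)[OF real_polynomial_function.intros(2)
          real_polynomial_function_sum[OF finite_atMost *]])
qed

lemma DERIV_bernoulli_poly:
  fixes x :: real
  shows "(bernoulli_poly (Suc n) has_real_derivative of_nat (Suc n) * bernoulli_poly n x) (at x within A)"
proof -
  define q where "q = fps_nth (fps_X / (fps_exp 1 - 1) :: real fps)"
  have term_deriv: "((\<lambda>x. q i * (x ^ (Suc n - i) / fact (Suc n - i))) has_real_derivative
          q i * (x ^ (n - i) / fact (n - i))) (at x within A)" if "i \<le> n" for i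
  proof -
    have "((\<lambda>x. x ^ Suc (n - i) / fact (Suc (n - i))) has_real_derivative
            real (Suc (n - i)) * x ^ (n - i) / fact (Suc (n - i))) (at x within A)"
      using DERIV_pow[of "Suc (n - i)" x A] by (intro DERIV_cdivide) simp
    also have "real (Suc (n - i)) * x ^ (n - i) / fact (Suc (n - i)) = x ^ (n - i) / fact (n - i)"
      by (simp del: of_nat_Suc)
    finally show ?thesis
      unfolding Suc_diff_le[OF that] by (rule DERIV_cmult)
  qed
  \<comment> \<open>The sum stops at n: the remaining term of index \<open>Suc n\<close> is constant
    in x and is added back below.\<close>
  have sum_deriv: "((\<lambda>x. \<Sum>i\<le>n. q i * (x ^ (Suc n - i) / fact (Suc n - i))) has_real_derivative
          (\<Sum>i\<le>n. q i * (x ^ (n - i) / fact (n - i)))) (at x within A)"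
    by (intro DERIV_sum term_deriv) simp
  have "((\<lambda>x. fact (Suc n) * ((\<Sum>i\<le>n. q i * (x ^ (Suc n - i) / fact (Suc n - i))) + q (Suc n)))
          has_real_derivative fact (Suc n) * ((\<Sum>i\<le>n. q i * (x ^ (n - i) / fact (n - i))) + 0)) (at x within A)"
    by (intro DERIV_cmult DERIV_add sum_deriv DERIV_const)
  moreover have "bernoulli_poly (Suc n) =
      (\<lambda>x. fact (Suc n) * ((\<Sum>i\<le>n. q i * (x ^ (Suc n - i) / fact (Suc n - i))) + q (Suc n)))"
    by (rule ext) (simp add: bernoulli_poly_eq_sum q_def del: fact_Suc)
  moreover have "real (Suc n) * bernoulli_poly n x =
      fact (Suc n) * ((\<Sum>i\<le>n. q i * (x ^ (n - i) / fact (n - i))) + 0)"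
    by (simp add: bernoulli_poly_eq_sum q_def)
  ultimately show ?thesis by (simp only:)
qed

text \<open>The antiderivative B_{n+1}/(n+1) takes equal values at 0 and 1, since its forward
  difference at 0 is 0^n = 0 for n > 0.\<close>

lemma has_integral_bernoulli_poly:
  assumes "n > 0"
  shows "(bernoulli_poly n has_integral (0 :: real)) {0..1}"
proof -
  have "((\<lambda>x. of_nat (Suc n) * bernoulli_poly n x) has_integral
          (bernoulli_poly (Suc n) 1 - bernoulli_poly (Suc n) (0 :: real))) {0..1}"
    using DERIV_bernoulli_poly
    by (intro fundamental_theorem_of_calculus) (auto simp flip: has_real_derivative_iff_has_vector_derivative)
  then have "((\<lambda>x. of_nat (Suc n) * bernoulli_poly n x) has_integral (0 :: real)) {0..1}"
    using bernoulli_poly_diff[of n "0 :: real"] assms by (simp add: power_0_left)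
  from has_integral_mult_right[OF this, of "inverse (real (Suc n))"] show ?thesis
    by (simp flip: mult.assoc del: of_nat_Suc)
qed

section \<open>Stirling sums of Bernoulli polynomials\<close>

lemma real_polynomial_function_pochhammer: "real_polynomial_function (\<lambda>t. pochhammer (t + s) n)"
  unfolding pochhammer_prod
  by (intro real_polynomial_function_prod real_polynomial_function.intros(2) real_polynomial_function.intros(3)
        real_polynomial_function.intros(1)[OF bounded_linear_ident]) auto

lemma poly_pochhammer: "poly (pochhammer p n) x = pochhammer (poly p x) n"
  by (induction n) (simp_all add: pochhammer_Suc)

text \<open>The forward difference of B_l(y)/l is y^(l-1), so the left side has difference (y)_k / y
  = (y+1)_{k-1}, the same as (y)_k / k. The left side has mean 0, which fixes the constant.\<close>

lemma sum_stirling_bernoulli_poly: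
  fixes y :: real
  assumes "k > 0"
  shows "(\<Sum>l=1..k. real (stirling k l) * bernoulli_poly l y / real l) =
           (pochhammer y k - integral {0..1} (\<lambda>t. pochhammer t k)) / real k"
proof -
  obtain m where k: "k = Suc m" using assms by (cases k) auto
  have diff: "(\<Sum>l=1..k. real (stirling k l) * bernoulli_poly l (y + 1) / real l) -
          (\<Sum>l=1..k. real (stirling k l) * bernoulli_poly l y / real l) =
        pochhammer (y + 1) k / real k - pochhammer y k / real k" for y :: real
  proof -
    let ?L = "\<lambda>y::real. \<Sum>l=1..k. real (stirling k l) * y ^ (l - 1)"
    have "bernoulli_poly l (y + 1) - bernoulli_poly l y = real l * y ^ (l - 1)" if "l \<in> {1..k}" for l
      using bernoulli_poly_diff[of "l - 1" y] that by simp
    then have "(\<Sum>l=1..k. real (stirling k l) * bernoulli_poly l (y + 1) / real l) -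
          (\<Sum>l=1..k. real (stirling k l) * bernoulli_poly l y / real l) = ?L y"
      unfolding sum_subtractf [symmetric] diff_divide_distrib [symmetric] right_diff_distrib [symmetric]
      by (intro sum.cong) auto
    also have "?L y = pochhammer (y + 1) m"
    proof -
      \<comment> \<open>The factor y is cancelled in the polynomial ring, so the value y = 0 is
        covered too.\<close>
      have "poly (\<Sum>l=1..k. monom (real (stirling k l)) (l - 1)) t * poly [:0, 1:] t =
              poly (pochhammer [:1, 1:] m) t * poly [:0, 1:] t" for t
      proof -
        have "poly (\<Sum>l=1..k. monom (real (stirling k l)) (l - 1)) t * t =
                (\<Sum>l=1..k. real (stirling k l) * t ^ l)"
          unfolding poly_sum poly_monom sum_distrib_right mult.assoc
          by (intro sum.cong refl) (simp add: power_minus_mult del: One_nat_def)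
        also have "\<dots> = pochhammer t k"
          unfolding stirling_pochhammer [symmetric]
          by (intro sum.mono_neutral_left) (auto simp: k not_less_eq_eq stirling_0)
        also have "\<dots> = poly (pochhammer [:1, 1:] m) t * t"
          by (simp add: k pochhammer_rec[of t] poly_pochhammer add_ac)
        finally show ?thesis by simp
      qed
      then have "(\<Sum>l=1..k. monom (real (stirling k l)) (l - 1)) * [:0, 1:] = pochhammer [:1, 1:] m * [:0, 1:]"
        unfolding poly_eq_poly_eq_iff [symmetric] by (simp add: fun_eq_iff)
      then have "(\<Sum>l=1..k. monom (real (stirling k l)) (l - 1)) = pochhammer [:1, 1:] m"
        by (simp only: mult_cancel_right) simp
      then have "poly (\<Sum>l=1..k. monom (real (stirling k l)) (l - 1)) y = poly (pochhammer [:1, 1:] m) y"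
        by simp
      then show ?thesis
        by (simp add: poly_sum poly_monom poly_pochhammer add_ac)
    qed
    also have "\<dots> = pochhammer (y + 1) k / real k - pochhammer y k / real k"
    proof -
      have "pochhammer (y + 1) k - pochhammer y k = real k * pochhammer (y + 1) m"
        unfolding k pochhammer_rec[of y] pochhammer_Suc[of "y + 1"] by (simp add: algebra_simps)
      then show ?thesis
        using assms by (simp flip: diff_divide_distrib)
    qed
    finally show ?thesis .
  qed
  have "(\<Sum>l=1..k. real (stirling k l) * bernoulli_poly l y / real l) =
          pochhammer y k / real k - integral {0..1} (\<lambda>t. pochhammer t k / real k)"
  proof (rule polynomial_eq_if_same_difference)
    show "real_polynomial_function (\<lambda>y. \<Sum>l=1..k. real (stirling k l) * bernoulli_poly l y / real l)"
      by (intro real_polynomial_function_sum real_polynomial_function_divide real_polynomial_function.intros(2)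
            real_polynomial_function.intros(4) real_polynomial_function_bernoulli_poly) auto
    show "real_polynomial_function (\<lambda>t. pochhammer t k / real k)"
      using real_polynomial_function_pochhammer[of 0 k]
      by (intro real_polynomial_function_divide) simp
    have "((\<lambda>y::real. \<Sum>l=1..k. real (stirling k l) * bernoulli_poly l y / real l)
             has_integral (\<Sum>l=1..k. real (stirling k l) * 0 / real l)) {0..1}"
      by (intro has_integral_sum has_integral_divide has_integral_mult_right has_integral_bernoulli_poly) auto
    then show "((\<lambda>y::real. \<Sum>l=1..k. real (stirling k l) * bernoulli_poly l y / real l) has_integral 0) {0..1}"
      by simp
  qed (rule diff)
  then show ?thesis by (simp add: diff_divide_distrib)
qed

text \<open>Here the differences are y^l and add up to (y)_k, the term l = 0 being zero for k > 0.
  This is the forward difference of (y-1)_{k+1}/(k+1), whence the shift by -1.\<close>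

lemma sum_stirling_bernoulli_poly_Suc:
  fixes y :: real
  assumes "k > 0"
  shows "(\<Sum>l=1..k. real (stirling k l) * bernoulli_poly (Suc l) y / real (Suc l)) =
           (pochhammer (y - 1) (Suc k) - integral {0..1} (\<lambda>t. pochhammer (t - 1) (Suc k))) / real (Suc k)"
proof -
  have diff: "(\<Sum>l=1..k. real (stirling k l) * bernoulli_poly (Suc l) (y + 1) / real (Suc l)) -
          (\<Sum>l=1..k. real (stirling k l) * bernoulli_poly (Suc l) y / real (Suc l)) =
        pochhammer (y + 1 - 1) (Suc k) / real (Suc k) - pochhammer (y - 1) (Suc k) / real (Suc k)" for y :: real
  proof -
    have "(\<Sum>l=1..k. real (stirling k l) * bernoulli_poly (Suc l) (y + 1) / real (Suc l)) -
          (\<Sum>l=1..k. real (stirling k l) * bernoulli_poly (Suc l) y / real (Suc l)) =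
          (\<Sum>l=1..k. real (stirling k l) * y ^ l)"
      unfolding sum_subtractf [symmetric] diff_divide_distrib [symmetric] right_diff_distrib [symmetric]
        bernoulli_poly_diff
      by (intro sum.cong) (auto simp del: of_nat_Suc)
    also have "\<dots> = pochhammer y k"
      unfolding stirling_pochhammer [symmetric] using assms
      by (intro sum.mono_neutral_left) (auto simp: not_less_eq_eq stirling_0)
    also have "\<dots> = pochhammer (y + 1 - 1) (Suc k) / real (Suc k) - pochhammer (y - 1) (Suc k) / real (Suc k)"
    proof -
      have "pochhammer (y + 1 - 1) (Suc k) - pochhammer (y - 1) (Suc k) = real (Suc k) * pochhammer y k"
        unfolding pochhammer_rec[of "y - 1"] pochhammer_Suc[of "y + 1 - 1"] by (simp add: algebra_simps)
      then show ?thesis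
        unfolding diff_divide_distrib [symmetric] by (simp del: of_nat_Suc)
    qed
    finally show ?thesis .
  qed
  have "(\<Sum>l=1..k. real (stirling k l) * bernoulli_poly (Suc l) y / real (Suc l)) =
          pochhammer (y - 1) (Suc k) / real (Suc k) -
          integral {0..1} (\<lambda>t. pochhammer (t - 1) (Suc k) / real (Suc k))"
  proof (rule polynomial_eq_if_same_difference)
    show "real_polynomial_function (\<lambda>y. \<Sum>l=1..k. real (stirling k l) * bernoulli_poly (Suc l) y / real (Suc l))"
      by (intro real_polynomial_function_sum real_polynomial_function_divide real_polynomial_function.intros(2)
            real_polynomial_function.intros(4) real_polynomial_function_bernoulli_poly) auto
    show "real_polynomial_function (\<lambda>t. pochhammer (t - 1) (Suc k) / real (Suc k))"
      using real_polynomial_function_pochhammer[of "-1" "Suc k"]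
      by (intro real_polynomial_function_divide) simp
    have "((\<lambda>y::real. \<Sum>l=1..k. real (stirling k l) * bernoulli_poly (Suc l) y / real (Suc l))
             has_integral (\<Sum>l=1..k. real (stirling k l) * 0 / real (Suc l))) {0..1}"
      by (intro has_integral_sum has_integral_divide has_integral_mult_right has_integral_bernoulli_poly) auto
    then show "((\<lambda>y::real. \<Sum>l=1..k. real (stirling k l) * bernoulli_poly (Suc l) y / real (Suc l)) has_integral 0) {0..1}"
      by simp
  qed (rule diff)
  then show ?thesis by (simp add: diff_divide_distrib)
qed

lemma bernoulli_poly_1:
  fixes y :: real
  shows "bernoulli_poly 1 y = y - 1 / 2"
proof -
  have "bernoulli_poly 1 y = y - integral {0..1} (\<lambda>t. t)"
  proof (rule polynomial_eq_if_same_difference)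
    show "bernoulli_poly 1 (y + 1) - bernoulli_poly 1 y = y + 1 - y" for y :: real
      using bernoulli_poly_diff[of 0 y] by simp
  qed (auto intro!: real_polynomial_function_bernoulli_poly has_integral_bernoulli_poly
         real_polynomial_function.intros(1) bounded_linear_ident)
  then show ?thesis by simp
qed

section \<open>The shifts s = -1 and s = 0\<close>

lemma harm_Newton_sums:
  fixes x :: real
  assumes "x > 0"
  shows "(\<lambda>n. (integral {0..1} (\<lambda>t. pochhammer (t - 1) (Suc n)) - pochhammer (frac x - 1) (Suc n)) /
                (real (Suc n) * pochhammer x (Suc n)))
           sums (harm (nat \<lfloor>x\<rfloor>) - ln x - euler_mascheroni)"
proof -
  have "\<bar>pochhammer (t - 1) (Suc n)\<bar> / pochhammer x (Suc n) \<le> 1 * (fact n / pochhammer x (Suc n))"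
    if "t \<in> {0..1}" for t n
  proof -
    \<comment> \<open>The factor t - 1 is the only one that can be negative; the others are bounded
      by those of (1)_n = n!.\<close>
    have "\<bar>pochhammer (t - 1) (Suc n)\<bar> = \<bar>t - 1\<bar> * pochhammer t n"
      using that by (simp add: pochhammer_rec[of "t - 1"] abs_mult pochhammer_nonneg_arg)
    also have "\<dots> \<le> 1 * pochhammer 1 n"
      using that by (intro mult_mono pochhammer_mono_arg) (auto simp: pochhammer_nonneg_arg)
    finally show ?thesis
      using pochhammer_pos[OF assms, of "Suc n"]
      by (simp add: divide_right_mono flip: pochhammer_fact)
  qed
  then show ?thesis
    using harm_inverse_factorial_sums[of x "-1" 1] assms by simp
qed

lemma harm_Newton_sums_plus1:
  fixes x :: real
  assumes "x > 0"
  shows "(\<lambda>n. (integral {0..1} (\<lambda>t. pochhammer t (Suc n)) - pochhammer (frac x) (Suc n)) /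
                (real (Suc n) * pochhammer (x + 1) (Suc n)))
           sums (harm (nat \<lfloor>x\<rfloor>) - ln x - euler_mascheroni)"
proof -
  have "\<bar>pochhammer t (Suc n)\<bar> / pochhammer (x + 1) (Suc n) \<le> x * (fact n / pochhammer x (Suc n))"
    if "t \<in> {0..1}" for t n
  proof -
    have "\<bar>pochhammer t (Suc n)\<bar> \<le> pochhammer 1 (Suc n)"
      using that pochhammer_mono_arg[of t 1 "Suc n"] pochhammer_nonneg_arg[of t "Suc n"] by simp
    then have "\<bar>pochhammer t (Suc n)\<bar> / pochhammer (x + 1) (Suc n) \<le> fact (Suc n) / pochhammer (x + 1) (Suc n)"
      unfolding pochhammer_fact using assms by (intro divide_right_mono pochhammer_nonneg_arg) auto
    \<comment> \<open>Since x (x+1)_{n+1} = (x)_{n+2}, the constant is K = x; monotonicity of the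
      majorant then lowers the index by one.\<close>
    also have "\<dots> = x * (fact (Suc n) / pochhammer x (Suc (Suc n)))"
      using assms by (simp add: pochhammer_rec[of x "Suc n"] del: fact_Suc)
    also have "\<dots> \<le> x * (fact n / pochhammer x (Suc n))"
      using decseq_SucD[OF decseq_fact_over_pochhammer[OF assms], of n] assms by (intro mult_left_mono) auto
    finally show ?thesis .
  qed
  then show ?thesis
    using harm_inverse_factorial_sums[of x 0 x] assms by simp
qed

text \<open>The sign (-1)^(k+l) inside \<open>stirling1\<close> combines with the two explicit signs
  to -1 in every term, so no alternation remains.\<close>

lemma sum_stirling1_eq:
  fixes g h :: "nat \<Rightarrow> real"
  shows "(-1) ^ (k + 1) * (\<Sum>l\<in>A. (-1) ^ l / h l * of_int (stirling1 k l) * g l) =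
           - (\<Sum>l\<in>A. real (stirling k l) * g l / h l)"
proof -
  have "(-1) ^ (k + 1) * ((-1) ^ l / h l * of_int (stirling1 k l) * g l) = - (real (stirling k l) * g l / h l)" for l
  proof -
    have "(-1) ^ (k + 1) * ((-1) ^ l / h l * of_int (stirling1 k l) * g l) =
            - (((-1) ^ (k + l) * (-1) ^ (k + l)) * (real (stirling k l) * g l / h l))"
      by (simp add: stirling1_eq_stirling power_add)
    also have "(-1) ^ (k + l) * (-1) ^ (k + l) = (1 :: real)"
      by (simp flip: power_mult_distrib)
    finally show ?thesis by simp
  qed
  then show ?thesis
    unfolding sum_distrib_left sum_negf [symmetric] by (rule sum.cong[OF refl])
qed

text \<open>The \<open>summable\<close> conjuncts assert convergence, which an equation for
  \<open>suminf\<close> alone would not express. The series index is n = k - 1.\<close>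

theorem theorem5:
  fixes x :: real
  assumes "x > 0"
  shows "summable (\<lambda>n. let k = n + 1 in (-1) ^ (k + 1) *
             (\<Sum>l=1..k. (-1) ^ l / real (l + 1) * of_int (stirling1 k l) * bernoulli_poly (l + 1) (frac x)) /
             (\<Prod>j=0..k. x + real j))
       \<and> (\<Sum>k=1..nat \<lfloor>x\<rfloor>. 1 / real k) =
           ln x + euler_mascheroni - bernoulli_poly 1 (frac x) / x +
           (\<Sum>n. let k = n + 1 in (-1) ^ (k + 1) *
             (\<Sum>l=1..k. (-1) ^ l / real (l + 1) * of_int (stirling1 k l) * bernoulli_poly (l + 1) (frac x)) /
             (\<Prod>j=0..k. x + real j))
       \<and> summable (\<lambda>n. let k = n + 1 in (-1) ^ (k + 1) *
             (\<Sum>l=1..k. (-1) ^ l / real l * of_int (stirling1 k l) * bernoulli_poly l (frac x)) /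
             (\<Prod>j=1..k. x + real j))
       \<and> (\<Sum>k=1..nat \<lfloor>x\<rfloor>. 1 / real k) =
           ln x + euler_mascheroni +
           (\<Sum>n. let k = n + 1 in (-1) ^ (k + 1) *
             (\<Sum>l=1..k. (-1) ^ l / real l * of_int (stirling1 k l) * bernoulli_poly l (frac x)) /
             (\<Prod>j=1..k. x + real j))"
proof -
  define S where "S = harm (nat \<lfloor>x\<rfloor>) - ln x - euler_mascheroni"
  have harm: "(\<Sum>k=1..nat \<lfloor>x\<rfloor>. 1 / real k) = ln x + euler_mascheroni + S"
    by (simp add: S_def harm_def inverse_eq_divide)
  define a where "a = (\<lambda>n. (integral {0..1} (\<lambda>t. pochhammer (t - 1) (Suc n)) - pochhammer (frac x - 1) (Suc n)) /
                (real (Suc n) * pochhammer x (Suc n)))"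
  \<comment> \<open>The product has k + 1 factors, so the summand for k = n + 1 is the Newton term
    of index k, and \<open>a 0\<close> is left over.\<close>
  have first: "(let k = n + 1 in (-1) ^ (k + 1) *
             (\<Sum>l=1..k. (-1) ^ l / real (l + 1) * of_int (stirling1 k l) * bernoulli_poly (l + 1) (frac x)) /
             (\<Prod>j=0..k. x + real j)) = a (Suc n)" for n
    unfolding Let_def sum_stirling1_eq pochhammer_Suc_prod [symmetric] a_def
    using sum_stirling_bernoulli_poly_Suc[of "Suc n" "frac x"]
    by (simp add: diff_divide_distrib del: of_nat_Suc sum.cl_ivl_Suc)
  have "integral {0..1} (\<lambda>t::real. t - 1) = - 1 / 2"
    using integral_diff[of "\<lambda>t::real. t" "{0..1}" "\<lambda>_. 1"]
    by (simp add: integrable_continuous_real)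
  \<comment> \<open>The leftover term is (-1/2 - (frac x - 1))/x, which is the separate B_1 term of
    the first formula.\<close>
  then have "a 0 = - bernoulli_poly 1 (frac x) / x"
    by (simp add: a_def bernoulli_poly_1 del: One_nat_def)
  moreover have "a sums S"
    unfolding a_def S_def by (rule harm_Newton_sums[OF assms])
  ultimately have sums1: "(\<lambda>n. a (Suc n)) sums (S + bernoulli_poly 1 (frac x) / x)"
    by (simp add: sums_Suc_iff)
  \<comment> \<open>Here the product starts at j = 1 and has k factors, so the terms match from
    index 0 and none is left over.\<close>
  have second: "(let k = n + 1 in (-1) ^ (k + 1) *
             (\<Sum>l=1..k. (-1) ^ l / real l * of_int (stirling1 k l) * bernoulli_poly l (frac x)) /
             (\<Prod>j=1..k. x + real j)) =
      (integral {0..1} (\<lambda>t. pochhammer t (Suc n)) - pochhammer (frac x) (Suc n)) /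
                (real (Suc n) * pochhammer (x + 1) (Suc n))" for n
  proof -
    have "(\<Prod>j=1..Suc n. x + real j) = pochhammer (x + 1) (Suc n)"
      unfolding pochhammer_Suc_prod One_nat_def prod.shift_bounds_cl_Suc_ivl by (simp add: add_ac)
    then show ?thesis
      unfolding Let_def sum_stirling1_eq
      using sum_stirling_bernoulli_poly[of "Suc n" "frac x"]
      by (simp add: diff_divide_distrib del: of_nat_Suc sum.cl_ivl_Suc prod.cl_ivl_Suc)
  qed
  note sums2 = harm_Newton_sums_plus1[OF assms, folded S_def]
  show ?thesis
    unfolding first second harm using sums1 sums2
    by (simp add: sums_iff)
qed

end
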